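(* Let $(X,M,* )$ be a uniformly locally finite fuzzy metric space (with $*$ having no zero divisors), and let $n\geq 0$ be an integer. If $\mathrm{asdim}(X)\leq n$, then for each $\varepsilon>0$, $t>0$, and $r\in(0,1)$, there exist $t'>0$, $r'\in(0,1)$, and non-empty finite subsets $A_x\subset B(x,r',t')\times\mathbb{N}$ for $x\in X$ such that $|A_x\Delta A_y|<\varepsilon|A_x\cap A_y|$ whenever $x,y\in X$ satisfy $M(x,y,t)>1-r$, and such that the projection of $A_x$ onto $X$ contains at most $n+1$ elements for each $x\in X$. In particular, every uniformly locally finite fuzzy metric space with finite asymptotic dimension has property A.
   Context: A continuous $t$-norm is a continuous, associative, commutative binary operation $*$ on $[0,1]$ with $a*1=a$ for all $a$, and $a*b\leq c*d$ whenever $a\leq c$ and $b\leq d$. Standing assumption: $*$ has no zero divisors, i.e. $a*b\neq 0$ whenever $a\neq 0$ and $b\neq 0$. A fuzzy metric space (George–Veeramani) is a triple $(X,M,* )$ with $X$ a set, $*$ a continuous $t$-norm, and $M:X\times X\times(0,\infty)\to[0,1]$ such that for all $x,y,z\in X$ and $s,t>0$: (1) $M(x,y,t)>0$; (2) $M(x,y,t)=1$ if and only if $x=y$; (3) $M(x,y,t)=M(y,x,t)$; (4) $M(x,y,t)*M(y,z,s)\leq M(x,z,t+s)$; (5) $M(x,y,\cdot)$ is continuous on $(0,\infty)$. For $x\in X$, $r\in(0,1)$, $t>0$, the ball is $B(x,r,t)=\{y\in X:M(x,y,t)>1-r\}$. The space is uniformly locally finite if for every $r\in(0,1)$ and $t>0$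 there is $N_{r,t}>0$ with $|B(x,r,t)|<N_{r,t}$ for all $x\in X$. A uniformly locally finite fuzzy metric space $(X,M,* )$ has property A if for every $\varepsilon>0$, $t>0$, $r\in(0,1)$ there exist $t'>0$, $r'\in(0,1)$ and a family $\{A_x\}_{x\in X}$ of non-empty finite subsets of $X\times\mathbb{N}$ such that $A_x\subset B(x,r',t')\times\mathbb{N}$ for each $x$, and $|A_x\Delta A_y|<\varepsilon|A_x\cap A_y|$ whenever $M(x,y,t)>1-r$. Here $\Delta$ is symmetric difference. A family $\mathcal{U}$ of subsets of $X$ is uniformly bounded if there exist $r\in(0,1)$ and $t>0$ such that $M(x,y,t)>1-r$ for all $x,y\in U$ and all $U\in\mathcal{U}$. Two subsets $U,U'$ are $(r,t)$-disjoint if $\sup\{M(x,y,t):x\in U,y\in U'\}<1-r$; a family is $(r,t)$-disjoint if any two distinct members are $(r,t)$-disjoint. One writes $\mathrm{asdim}(X)\leq n$ if for every $r\in(0,1)$ and $t>0$ there exist $(r,t)$-disjoint families $\mathcal{U}^0,\ldots,\mathcal{U}^n$ of subsets of $X$ such that $\bigcup_i\mathcal{U}^i$ is a uniformly bounded cover of $X$. Finite asymptotic dimension means $\mathrm{asdim}(X)\leq n$ for some $n$. *)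

theory Defs
  imports Complex_Main
begin

locale continuous_t_norm =
  fixes star :: "real \<Rightarrow> real \<Rightarrow> real"
  assumes star_closed: "a \<in> {0..1} \<Longrightarrow> b \<in> {0..1} \<Longrightarrow> star a b \<in> {0..1}"
    and star_assoc: "a \<in> {0..1} \<Longrightarrow> b \<in> {0..1} \<Longrightarrow> c \<in> {0..1} \<Longrightarrow>
      star (star a b) c = star a (star b c)"
    and star_commute: "a \<in> {0..1} \<Longrightarrow> b \<in> {0..1} \<Longrightarrow> star a b = star b a"
    and star_one: "a \<in> {0..1} \<Longrightarrow> star a 1 = a"
    and star_mono: "a \<in> {0..1} \<Longrightarrow> b \<in> {0..1} \<Longrightarrow> c \<in> {0..1} \<Longrightarrow> d \<in> {0..1} \<Longrightarrow>
      a \<le> c \<Longrightarrow> b \<le> d \<Longrightarrow> star a b \<le> star c d"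
    and star_continuous: "continuous_on ({0..1} \<times> {0..1}) (\<lambda>(a, b). star a b)"

definition no_zero_divisors_on_unit :: "(real \<Rightarrow> real \<Rightarrow> real) \<Rightarrow> bool" where
  "no_zero_divisors_on_unit star \<longleftrightarrow>
    (\<forall>a\<in>{0..1}. \<forall>b\<in>{0..1}. a \<noteq> 0 \<longrightarrow> b \<noteq> 0 \<longrightarrow> star a b \<noteq> 0)"

text \<open>Fuzzy metric spaces in the sense of George and Veeramani. Values of \<open>M\<close> outside
  \<open>X \<times> X \<times> (0, \<infinity>)\<close> and values of \<open>star\<close> outside \<open>[0, 1] \<times> [0, 1]\<close> are irrelevant.\<close>

locale fuzzy_metric_space = continuous_t_norm star
  for X :: "'a set" and M :: "'a \<Rightarrow> 'a \<Rightarrow> real \<Rightarrow> real" and star :: "real \<Rightarrow> real \<Rightarrow> real" +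
  assumes M_range: "x \<in> X \<Longrightarrow> y \<in> X \<Longrightarrow> t > 0 \<Longrightarrow> M x y t \<in> {0..1}"
    and M_pos: "x \<in> X \<Longrightarrow> y \<in> X \<Longrightarrow> t > 0 \<Longrightarrow> M x y t > 0"
    and M_eq_1_iff: "x \<in> X \<Longrightarrow> y \<in> X \<Longrightarrow> t > 0 \<Longrightarrow> M x y t = 1 \<longleftrightarrow> x = y"
    and M_commute: "x \<in> X \<Longrightarrow> y \<in> X \<Longrightarrow> t > 0 \<Longrightarrow> M x y t = M y x t"
    and M_triangle: "x \<in> X \<Longrightarrow> y \<in> X \<Longrightarrow> z \<in> X \<Longrightarrow> s > 0 \<Longrightarrow> t > 0 \<Longrightarrow>
      star (M x y t) (M y z s) \<le> M x z (t + s)"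
    and M_continuous: "x \<in> X \<Longrightarrow> y \<in> X \<Longrightarrow> continuous_on {0<..} (\<lambda>t. M x y t)"

definition fuzzy_ball ::
    "'a set \<Rightarrow> ('a \<Rightarrow> 'a \<Rightarrow> real \<Rightarrow> real) \<Rightarrow> 'a \<Rightarrow> real \<Rightarrow> real \<Rightarrow> 'a set" where
  "fuzzy_ball X M x r t = {y \<in> X. M x y t > 1 - r}"

definition uniformly_locally_finite ::
    "'a set \<Rightarrow> ('a \<Rightarrow> 'a \<Rightarrow> real \<Rightarrow> real) \<Rightarrow> bool" where
  "uniformly_locally_finite X M \<longleftrightarrow>
    (\<forall>r\<in>{0<..<1}. \<forall>t>0. \<exists>N::nat. N > 0 \<and>
      (\<forall>x\<in>X. finite (fuzzy_ball X M x r t) \<and> card (fuzzy_ball X M x r t) < N))"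

definition property_A ::
    "'a set \<Rightarrow> ('a \<Rightarrow> 'a \<Rightarrow> real \<Rightarrow> real) \<Rightarrow> bool" where
  "property_A X M \<longleftrightarrow>
    (\<forall>\<epsilon>>0. \<forall>t>0. \<forall>r\<in>{0<..<1}. \<exists>t'>0. \<exists>r'\<in>{0<..<1}. \<exists>A :: 'a \<Rightarrow> ('a \<times> nat) set.
      (\<forall>x\<in>X. A x \<noteq> {} \<and> finite (A x) \<and> A x \<subseteq> fuzzy_ball X M x r' t' \<times> UNIV) \<and>
      (\<forall>x\<in>X. \<forall>y\<in>X. M x y t > 1 - r \<longrightarrow>
        real (card (sym_diff (A x) (A y))) < \<epsilon> * real (card (A x \<inter> A y))))"

definition uniformly_bounded_family ::
    "('a \<Rightarrow> 'a \<Rightarrow> real \<Rightarrow> real) \<Rightarrow> 'a set set \<Rightarrow> bool" where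
  "uniformly_bounded_family M \<U> \<longleftrightarrow>
    (\<exists>r\<in>{0<..<1}. \<exists>t>0. \<forall>U\<in>\<U>. \<forall>x\<in>U. \<forall>y\<in>U. M x y t > 1 - r)"

text \<open>The supremum is taken in \<open>[0, 1]\<close>, so the empty supremum is \<open>0\<close>. As \<open>Sup {}\<close> is
  unspecified on \<^typ>\<open>real\<close>, the value \<open>0\<close> is inserted; since \<open>M\<close> is nonnegative, this
  changes nothing when \<open>U\<close> and \<open>V\<close> are nonempty.\<close>

definition fuzzy_disjoint ::
    "('a \<Rightarrow> 'a \<Rightarrow> real \<Rightarrow> real) \<Rightarrow> real \<Rightarrow> real \<Rightarrow> 'a set \<Rightarrow> 'a set \<Rightarrow> bool" where
  "fuzzy_disjoint M r t U V \<longleftrightarrow> Sup (insert 0 {M x y t | x y. x \<in> U \<and> y \<in> V}) < 1 - r"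

definition fuzzy_disjoint_family ::
    "('a \<Rightarrow> 'a \<Rightarrow> real \<Rightarrow> real) \<Rightarrow> real \<Rightarrow> real \<Rightarrow> 'a set set \<Rightarrow> bool" where
  "fuzzy_disjoint_family M r t \<U> \<longleftrightarrow>
    (\<forall>U\<in>\<U>. \<forall>V\<in>\<U>. U \<noteq> V \<longrightarrow> fuzzy_disjoint M r t U V)"

definition asdim_le ::
    "'a set \<Rightarrow> ('a \<Rightarrow> 'a \<Rightarrow> real \<Rightarrow> real) \<Rightarrow> nat \<Rightarrow> bool" where
  "asdim_le X M n \<longleftrightarrow>
    (\<forall>r\<in>{0<..<1}. \<forall>t>0. \<exists>\<U> :: nat \<Rightarrow> 'a set set.
      (\<forall>i\<le>n. \<U> i \<subseteq> Pow X \<and> fuzzy_disjoint_family M r t (\<U> i)) \<and>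
      uniformly_bounded_family M (\<Union>i\<le>n. \<U> i) \<and>
      \<Union>(\<Union>i\<le>n. \<U> i) = X)"

definition finite_asdim ::
    "'a set \<Rightarrow> ('a \<Rightarrow> 'a \<Rightarrow> real \<Rightarrow> real) \<Rightarrow> bool" where
  "finite_asdim X M \<longleftrightarrow> (\<exists>n. asdim_le X M n)"

end

theory Submission
  imports Defs
begin

text \<open>Join \<open>x\<close> and \<open>y\<close> by an edge when \<open>M x y t > 1 - r\<close>. As \<open>star\<close> has no zero divisors, a
  chain of \<open>k\<close> edges forces \<open>M\<close> at time \<open>(k + 1) t\<close> to be at least a positive constant, so finite
  asymptotic dimension provides a uniformly bounded cover by \<open>n + 1\<close> families in which distinct
  members are more than \<open>2 R\<close> edges apart. Over a chosen point of each member \<open>U\<close> at edge distance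
  \<open>d \<le> R\<close> from \<open>x\<close> put a column of height \<open>R + 1 - d\<close>; these columns form \<open>A x\<close>. Only \<open>n + 1\<close>
  members come this close to \<open>x\<close>, and a move along an edge changes each height by at most one,
  whereas a member containing \<open>x\<close> contributes at least \<open>R\<close> common points. Hence any
  \<open>R > 2 (n + 1) / \<epsilon>\<close> works.\<close>

section \<open>Columns of points over a relation on an arbitrary set\<close>

definition columns ::
    "('a \<times> 'a) set \<Rightarrow> nat \<Rightarrow> 'a set set \<Rightarrow> ('a set \<Rightarrow> 'a) \<Rightarrow> 'a \<Rightarrow> ('a \<times> nat) set" where
  "columns E R \<V> c x =
    {(c U, m) | U m. U \<in> \<V> \<and> (\<exists>k. \<exists>u\<in>U. (x, u) \<in> E ^^ k \<and> k + m \<le> R)}"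

lemma columns_downward:
  assumes "(p, m) \<in> columns E R \<V> c x" and "l \<le> m"
  shows "(p, l) \<in> columns E R \<V> c x"
proof -
  obtain U k u where "U \<in> \<V>" "p = c U" "u \<in> U" "(x, u) \<in> E ^^ k" "k + m \<le> R"
    using assms(1) unfolding columns_def by blast
  moreover from this have "k + l \<le> R"
    using assms(2) by simp
  ultimately show ?thesis
    unfolding columns_def by blast
qed

text \<open>Putting the edge in front of a walk costs one unit of length, paid for by one level of
  height. Walks of every length count in \<open>columns\<close>, not only shortest ones, so no
  distance function is required; the shortest walk alone decides how high the column rises.\<close>

lemma columns_step:
  assumes "(p, Suc m) \<in> columns E R \<V> c x" and "(y, x) \<in> E"
  shows "(p, m) \<in> columns E R \<V> c y"
proof -
  obtain U k u where "U \<in> \<V>" "p = c U" "u \<in> U" "(x, u) \<in> E ^^ k" "k + Suc m \<le> R"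
    using assms(1) unfolding columns_def by blast
  moreover from this have "(y, u) \<in> E ^^ Suc k" "Suc k + m \<le> R"
    using relpow_Suc_I2[OF assms(2)] by auto
  ultimately show ?thesis
    unfolding columns_def by blast
qed

lemma columns_self:
  assumes "U \<in> \<V>" and "x \<in> U" and "m \<le> R"
  shows "(c U, m) \<in> columns E R \<V> c x"
proof -
  have "(x, x) \<in> E ^^ 0" "0 + m \<le> R"
    using assms(3) by auto
  then show ?thesis
    using assms(1,2) unfolding columns_def by blast
qed

lemma finite_columns:
  assumes "finite (fst ` columns E R \<V> c x)"
  shows "finite (columns E R \<V> c x)"
proof (rule finite_subset)
  show "columns E R \<V> c x \<subseteq> fst ` columns E R \<V> c x \<times> {..R}"
    unfolding columns_def by force
qed (use assms in auto)

text \<open>Over one base point \<open>p\<close> the difference has at most one element: if it had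
  levels \<open>l < m\<close>, \<open>columns_step\<close> would put level \<open>m - 1\<close> over
  \<open>y\<close>, and \<open>columns_downward\<close> then level \<open>l\<close> too. So
  \<open>fst\<close> is injective on the difference.\<close>

lemma card_columns_diff_le:
  assumes "finite (fst ` columns E R \<V> c x)" and "(y, x) \<in> E"
  shows "card (columns E R \<V> c x - columns E R \<V> c y) \<le> card (fst ` columns E R \<V> c x)"
proof (rule card_inj_on_le)
  let ?D = "columns E R \<V> c x - columns E R \<V> c y"
  have not_less: "\<not> l < m" if "(p, l) \<in> ?D" "(p, m) \<in> ?D" for p l m
  proof
    assume "l < m"
    then obtain j where j: "m = Suc j" "l \<le> j"
      by (cases m) auto
    then have "(p, j) \<in> columns E R \<V> c y"
      using that(2) columns_step[OF _ assms(2)] by blast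
    then have "(p, l) \<in> columns E R \<V> c y"
      using j(2) by (rule columns_downward)
    then show False
      using that(1) by blast
  qed
  show "inj_on fst ?D"
  proof (rule inj_onI)
    fix a b assume *: "a \<in> ?D" "b \<in> ?D" "fst a = fst b"
    then obtain p l m where "a = (p, l)" "b = (p, m)"
      by (cases a, cases b) simp
    with * show "a = b"
      using not_less[of p l m] not_less[of p m l] by (simp add: linorder_neq_iff)
  qed
qed (use assms(1) in auto)

text \<open>The member containing \<open>x\<close> is reached by the walk of length 0, so its column
  over \<open>x\<close> has all levels 0 to \<open>R\<close>. Moving to \<open>y\<close> can lose
  only the top one, which leaves \<open>R\<close> common levels.\<close>

lemma card_columns_Int_ge:
  assumes "finite (columns E R \<V> c x)" and "(y, x) \<in> E" and "U \<in> \<V>" and "x \<in> U"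
  shows "R \<le> card (columns E R \<V> c x \<inter> columns E R \<V> c y)"
proof -
  have "(c U, m) \<in> columns E R \<V> c x \<inter> columns E R \<V> c y" if "m < R" for m
    using columns_self[OF assms(3,4), of _ R c E] columns_step[OF _ assms(2)] that by auto
  then have "{c U} \<times> {..<R} \<subseteq> columns E R \<V> c x \<inter> columns E R \<V> c y"
    by auto
  from card_mono[OF _ this] show ?thesis
    using assms(1) by simp
qed

lemma columns_projection:
  assumes unique: "\<And>i U V u v k l. \<lbrakk>i \<le> n; U \<in> \<U> i; V \<in> \<U> i; u \<in> U; v \<in> V;
      (x, u) \<in> E ^^ k; (x, v) \<in> E ^^ l; k \<le> R; l \<le> R\<rbrakk> \<Longrightarrow> U = V"
  shows "finite (fst ` columns E R (\<Union>i\<le>n. \<U> i) c x)"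
    and "card (fst ` columns E R (\<Union>i\<le>n. \<U> i) c x) \<le> n + 1"
proof -
  define near where "near i U \<longleftrightarrow> U \<in> \<U> i \<and> (\<exists>k\<le>R. \<exists>u\<in>U. (x, u) \<in> E ^^ k)" for i U
  have near_eq: "(SOME V. near i V) = U" if "i \<le> n" "near i U" for i U
  proof (rule some_equality)
    show "V = U" if "near i V" for V
      using unique[OF \<open>i \<le> n\<close>] that \<open>near i U\<close> unfolding near_def by blast
  qed (rule that(2))
  \<comment> \<open>An index without a near member receives an arbitrary \<open>SOME\<close> value;
    this can only enlarge the right-hand side.\<close>
  have sub: "fst ` columns E R (\<Union>i\<le>n. \<U> i) c x \<subseteq> (\<lambda>i. c (SOME V. near i V)) ` {..n}"
  proof
    fix p assume "p \<in> fst ` columns E R (\<Union>i\<le>n. \<U> i) c x"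
    then obtain i U k u m where *: "i \<le> n" "U \<in> \<U> i" "p = c U" "u \<in> U"
        "(x, u) \<in> E ^^ k" "k + m \<le> R"
      unfolding columns_def by auto
    then have "near i U"
      unfolding near_def by (meson add_leD1)
    with * show "p \<in> (\<lambda>i. c (SOME V. near i V)) ` {..n}"
      using near_eq by auto
  qed
  show "finite (fst ` columns E R (\<Union>i\<le>n. \<U> i) c x)"
    using sub by (rule finite_subset) simp
  have "card (fst ` columns E R (\<Union>i\<le>n. \<U> i) c x) \<le> card ((\<lambda>i. c (SOME V. near i V)) ` {..n})"
    using sub by (intro card_mono) auto
  also have "\<dots> \<le> n + 1"
    using card_image_le[of "{..n}" "\<lambda>i. c (SOME V. near i V)"] by simp
  finally show "card (fst ` columns E R (\<Union>i\<le>n. \<U> i) c x) \<le> n + 1" .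
qed

section \<open>The closeness graph and lower bounds for \<open>M\<close> along its walks\<close>

definition closeness_graph ::
    "'a set \<Rightarrow> ('a \<Rightarrow> 'a \<Rightarrow> real \<Rightarrow> real) \<Rightarrow> real \<Rightarrow> real \<Rightarrow> ('a \<times> 'a) set" where
  "closeness_graph X M r t = {(x, y). x \<in> X \<and> y \<in> X \<and> M x y t > 1 - r}"

text \<open>Loops at \<open>x\<close> pad a walk. Thus walks of length at most \<open>R\<close>
  become walks of length exactly \<open>R\<close>, and a single time parameter serves them
  all.\<close>

lemma relpow_mono_refl_on:
  assumes "refl_on X E" and "x \<in> X" and "(x, y) \<in> E ^^ k" and "k \<le> l"
  shows "(x, y) \<in> E ^^ l"
  using assms(4)
proof (induction l rule: dec_induct)
  case (step l)
  then show ?case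
    using relpow_Suc_I2[OF refl_onD[OF assms(1,2)]] by blast
qed (rule assms(3))

lemma sym_relpow:
  assumes "sym E"
  shows "sym (E ^^ k)"
proof (induction k)
  case (Suc k)
  show ?case
  proof (rule symI)
    fix x y assume "(x, y) \<in> E ^^ Suc k"
    then obtain z where "(x, z) \<in> E ^^ k" "(z, y) \<in> E"
      by auto
    then show "(y, x) \<in> E ^^ Suc k"
      using relpow_Suc_I2[of y z E x k] Suc.IH assms by (blast dest: symD)
  qed
qed (simp add: sym_def)

text \<open>On \<open>X\<close> the values of \<open>M\<close> are at most 1, so \<open>Sup\<close>
  is taken over a bounded set and really bounds each value.\<close>

lemma fuzzy_disjoint_less:
  assumes "fuzzy_metric_space X M star" and "t > 0" and "U \<subseteq> X" and "V \<subseteq> X"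
    and "fuzzy_disjoint M r t U V" and "u \<in> U" and "v \<in> V"
  shows "M u v t < 1 - r"
proof -
  interpret fuzzy_metric_space X M star by (rule assms(1))
  let ?S = "insert 0 {M x y t | x y. x \<in> U \<and> y \<in> V}"
  have "s \<le> 1" if "s \<in> ?S" for s
    using that M_range[OF _ _ assms(2)] assms(3,4) by fastforce
  then have "bdd_above ?S"
    unfolding bdd_above_def by blast
  then have "M u v t \<le> Sup ?S"
    using assms(6,7) by (intro cSup_upper) auto
  then show ?thesis
    using assms(5) unfolding fuzzy_disjoint_def by linarith
qed

context fuzzy_metric_space
begin

lemma refl_on_closeness_graph:
  assumes "t > 0" and "r > 0"
  shows "refl_on X (closeness_graph X M r t)"
proof (rule refl_onI)
  show "(x, x) \<in> closeness_graph X M r t" if "x \<in> X" for x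
    using M_eq_1_iff[of x x t] that assms unfolding closeness_graph_def by simp
qed

lemma sym_closeness_graph:
  assumes "t > 0"
  shows "sym (closeness_graph X M r t)"
  using M_commute[OF _ _ assms] unfolding closeness_graph_def sym_def by auto

lemma M_triangle_lower:
  assumes "x \<in> X" "y \<in> X" "z \<in> X" "s > 0" "t > 0" "a \<in> {0..1}" "b \<in> {0..1}"
    and "a \<le> M x y t" and "b \<le> M y z s"
  shows "star a b \<le> M x z (t + s)"
proof -
  have "star a b \<le> star (M x y t) (M y z s)"
    using assms M_range by (intro star_mono) blast+
  also have "\<dots> \<le> M x z (t + s)"
    using assms by (intro M_triangle)
  finally show ?thesis .
qed

text \<open>This is where the absence of zero divisors enters: lower bounds combined by the triangle
  inequality stay away from 0.\<close>

lemma star_pos: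
  assumes "no_zero_divisors_on_unit star" and "a \<in> {0<..1}" and "b \<in> {0<..1}"
  shows "star a b \<in> {0<..1}"
  using assms star_closed[of a b] unfolding no_zero_divisors_on_unit_def
  by (auto simp: less_le)

text \<open>Iterating the triangle inequality gives a product of \<open>k\<close> factors
  \<open>1 - r\<close>, which does not depend on the endpoints. The time has the factor
  \<open>Suc k\<close> because even a walk of length 0 needs a positive time.\<close>

lemma relpow_closeness_graph_lower:
  assumes nzd: "no_zero_divisors_on_unit star" and t: "t > 0" and r: "r \<in> {0<..<1}"
  obtains a where "a \<in> {0<..1}"
    and "\<And>x y. \<lbrakk>x \<in> X; (x, y) \<in> closeness_graph X M r t ^^ k\<rbrakk>
      \<Longrightarrow> y \<in> X \<and> a \<le> M x y (real (Suc k) * t)"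
proof (induction k arbitrary: thesis)
  case 0
  show ?case
  proof (rule 0[of 1])
    fix x y assume "x \<in> X" "(x, y) \<in> closeness_graph X M r t ^^ 0"
    then show "y \<in> X \<and> 1 \<le> M x y (real (Suc 0) * t)"
      using M_eq_1_iff[of x y t] t by auto
  qed simp
next
  case (Suc k)
  obtain a where a: "a \<in> {0<..1}"
    and bound: "\<And>x y. \<lbrakk>x \<in> X; (x, y) \<in> closeness_graph X M r t ^^ k\<rbrakk>
      \<Longrightarrow> y \<in> X \<and> a \<le> M x y (real (Suc k) * t)"
    using Suc.IH by blast
  show ?case
  proof (rule Suc.prems)
    show "star a (1 - r) \<in> {0<..1}"
      using a r by (intro star_pos[OF nzd]) auto
    fix x y assume x: "x \<in> X" and "(x, y) \<in> closeness_graph X M r t ^^ Suc k"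
    then obtain z where z: "(x, z) \<in> closeness_graph X M r t ^^ k" "y \<in> X" "1 - r < M z y t"
      unfolding closeness_graph_def by auto
    have "star a (1 - r) \<le> M x y (real (Suc k) * t + t)"
      using bound[OF x z(1)] z x a r t by (intro M_triangle_lower[of x z y]) auto
    also have "real (Suc k) * t + t = real (Suc (Suc k)) * t"
      by (simp add: algebra_simps)
    finally show "y \<in> X \<and> star a (1 - r) \<le> M x y (real (Suc (Suc k)) * t)"
      using z(2) by simp
  qed
qed

section \<open>From a cover of bounded dimension to the sets \<open>A x\<close>\<close>

lemma asdim_le_imp_columns:
  assumes nzd: "no_zero_divisors_on_unit star" and asdim: "asdim_le X M n"
    and eps: "\<epsilon> > (0::real)" and t: "t > 0" and r: "r \<in> {0<..<1}"
  obtains t' r' and A :: "'a \<Rightarrow> ('a \<times> nat) set"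
  where "t' > 0" and "r' \<in> {0<..<1}"
    and "\<forall>x\<in>X. A x \<noteq> {} \<and> finite (A x) \<and> A x \<subseteq> fuzzy_ball X M x r' t' \<times> UNIV"
    and "\<forall>x\<in>X. \<forall>y\<in>X. M x y t > 1 - r \<longrightarrow>
      real (card (sym_diff (A x) (A y))) < \<epsilon> * real (card (A x \<inter> A y))"
    and "\<forall>x\<in>X. card (fst ` A x) \<le> n + 1"
proof -
  define E where "E = closeness_graph X M r t"
  have reflE: "refl_on X E" and symE: "sym E"
    using refl_on_closeness_graph[OF t] sym_closeness_graph[OF t] r by (auto simp: E_def)
  obtain R :: nat where "2 * (real n + 1) / \<epsilon> < real R"
    using reals_Archimedean2 by blast
  then have R: "2 * (real n + 1) < \<epsilon> * real R"
    using eps by (simp add: divide_less_eq mult.commute)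
  obtain a where a: "a \<in> {0<..1}"
    and a_bound: "\<And>x y. \<lbrakk>x \<in> X; (x, y) \<in> E ^^ R\<rbrakk> \<Longrightarrow> y \<in> X \<and> a \<le> M x y (real (Suc R) * t)"
    using relpow_closeness_graph_lower[OF nzd t r, of R] unfolding E_def by blast
  obtain b where b: "b \<in> {0<..1}"
    and b_bound: "\<And>x y. \<lbrakk>x \<in> X; (x, y) \<in> E ^^ (2 * R)\<rbrakk>
      \<Longrightarrow> y \<in> X \<and> b \<le> M x y (real (Suc (2 * R)) * t)"
    using relpow_closeness_graph_lower[OF nzd t r, of "2 * R"] unfolding E_def by blast
  define t1 where "t1 = real (Suc (2 * R)) * t"
  \<comment> \<open>Radius \<open>1 - b / 2\<close> makes distinct members of one family satisfy
    \<open>M < b / 2\<close> at time \<open>t1\<close>, against the bound \<open>b\<close> for walks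
    of length \<open>2 * R\<close>. Halving keeps the radius positive even if
    \<open>b = 1\<close>.\<close>
  have t1: "t1 > 0" and b1: "1 - b / 2 \<in> {0<..<1}"
    using t b by (auto simp: t1_def intro!: mult_pos_pos)
  obtain \<U> :: "nat \<Rightarrow> 'a set set" where
      disj: "\<And>i. i \<le> n \<Longrightarrow> \<U> i \<subseteq> Pow X \<and> fuzzy_disjoint_family M (1 - b / 2) t1 (\<U> i)"
      and bdd: "uniformly_bounded_family M (\<Union>i\<le>n. \<U> i)" and cover: "\<Union>(\<Union>i\<le>n. \<U> i) = X"
    using asdim b1 t1 unfolding asdim_le_def by metis
  define \<V> where "\<V> = (\<Union>i\<le>n. \<U> i)"
  obtain r0 t0 where r0: "r0 \<in> {0<..<1}" and t0: "t0 > 0"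
      and diam: "\<forall>U\<in>\<V>. \<forall>x\<in>U. \<forall>y\<in>U. M x y t0 > 1 - r0"
    using bdd unfolding uniformly_bounded_family_def \<V>_def[symmetric] by (elim bexE exE conjE)
  define c where "c U = (SOME p. p \<in> U)" for U :: "'a set"
  have c: "c U \<in> U" if "u \<in> U" for u U
    unfolding c_def using that by (rule someI)
  define A where "A = columns E R \<V> c"
  have proj: "finite (fst ` A x)" "card (fst ` A x) \<le> n + 1" if x: "x \<in> X" for x
  proof -
    have unique: "U = V" if "i \<le> n" "U \<in> \<U> i" "V \<in> \<U> i" "u \<in> U" "v \<in> V"
        "(x, u) \<in> E ^^ k" "(x, v) \<in> E ^^ l" "k \<le> R" "l \<le> R" for i U V u v k l
    proof (rule ccontr)
      assume "U \<noteq> V"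
      have sub: "U \<subseteq> X" "V \<subseteq> X"
        using disj[OF that(1)] that(2,3) by auto
      \<comment> \<open>Going back from \<open>u\<close> to \<open>x\<close> and on to
        \<open>v\<close> takes \<open>k + l\<close> edges, at most \<open>2 * R\<close>.\<close>
      have "(u, x) \<in> E ^^ k"
        using that(6) sym_relpow[OF symE] by (auto dest: symD)
      then have "(u, v) \<in> E ^^ (k + l)"
        using that(7) by (auto simp: relpow_add)
      then have "(u, v) \<in> E ^^ (2 * R)"
        using relpow_mono_refl_on[OF reflE, of u] that sub by auto
      then have "b \<le> M u v t1"
        using b_bound that(4) sub unfolding t1_def by blast
      moreover have "fuzzy_disjoint M (1 - b / 2) t1 U V"
        using disj[OF that(1)] that(2,3) \<open>U \<noteq> V\<close> unfolding fuzzy_disjoint_family_def by blast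
      then have "M u v t1 < 1 - (1 - b / 2)"
        using fuzzy_disjoint_less[OF fuzzy_metric_space_axioms t1 sub] that(4,5) by blast
      ultimately show False
        using b by simp
    qed
    show "finite (fst ` A x)" "card (fst ` A x) \<le> n + 1"
      using columns_projection[of n \<U> x E R c] unique unfolding A_def \<V>_def by blast+
  qed
  have fin: "finite (A x)" if "x \<in> X" for x
    using proj(1)[OF that] unfolding A_def by (rule finite_columns)
  have covered: "\<exists>U\<in>\<V>. x \<in> U" if "x \<in> X" for x
    using that cover unfolding \<V>_def by blast
  \<comment> \<open>From \<open>x\<close> to a base point: a walk of length \<open>R\<close> into
    the member (bound \<open>a\<close>), then one jump inside the member (bound
    \<open>1 - r0\<close>). The radius \<open>1 - d / 2\<close> below turns \<open>d \<le> M\<close>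
    into the strict inequality that a ball demands.\<close>
  define d where "d = star a (1 - r0)"
  have d: "d \<in> {0<..1}"
    unfolding d_def using a r0 by (intro star_pos[OF nzd]) auto
  define t' where "t' = real (Suc R) * t + t0"
  have ball: "A x \<subseteq> fuzzy_ball X M x (1 - d / 2) t' \<times> UNIV" if x: "x \<in> X" for x
  proof
    fix q assume "q \<in> A x"
    then obtain U k u m where q: "q = (c U, m)" "U \<in> \<V>" "u \<in> U" "(x, u) \<in> E ^^ k" "k + m \<le> R"
      unfolding A_def columns_def by blast
    have "(x, u) \<in> E ^^ R"
      using relpow_mono_refl_on[OF reflE x q(4)] q(5) by simp
    then have u: "u \<in> X" "a \<le> M x u (real (Suc R) * t)"
      using a_bound[OF x] by auto
    have cU: "c U \<in> X" "1 - r0 < M u (c U) t0"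
      using c[OF q(3)] q(2,3) diam cover unfolding \<V>_def by auto
    have "d \<le> M x (c U) t'"
      unfolding d_def t'_def using x u cU t t0 a r0
      by (intro M_triangle_lower[of x u "c U"]) (auto intro!: mult_pos_pos)
    then show "q \<in> fuzzy_ball X M x (1 - d / 2) t' \<times> UNIV"
      using q(1) cU(1) d unfolding fuzzy_ball_def by auto
  qed
  have ne: "A x \<noteq> {}" if x: "x \<in> X" for x
    using covered[OF x] columns_self[of _ \<V> x 0 R c E] unfolding A_def by auto
  have close: "real (card (sym_diff (A x) (A y))) < \<epsilon> * real (card (A x \<inter> A y))"
    if x: "x \<in> X" and y: "y \<in> X" and xy: "M x y t > 1 - r" for x y
  proof -
    have E: "(x, y) \<in> E" "(y, x) \<in> E"
      using x y xy symE unfolding E_def closeness_graph_def by (auto dest: symD)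
    have "card (A x - A y) \<le> n + 1" "card (A y - A x) \<le> n + 1"
      using card_columns_diff_le[of E R \<V> c, OF _ E(2)] card_columns_diff_le[of E R \<V> c, OF _ E(1)]
        proj[OF x] proj[OF y] unfolding A_def by (meson le_trans)+
    then have "card (sym_diff (A x) (A y)) \<le> (n + 1) + (n + 1)"
      by (intro order_trans[OF card_Un_le] add_mono)
    then have "real (card (sym_diff (A x) (A y))) \<le> real ((n + 1) + (n + 1))"
      by (rule of_nat_mono)
    also have "\<dots> = 2 * (real n + 1)"
      by simp
    also note R
    also have "R \<le> card (A x \<inter> A y)"
      using card_columns_Int_ge[of E R \<V> c x y] fin[OF x] E(2) covered[OF x] unfolding A_def by blast
    then have "\<epsilon> * real R \<le> \<epsilon> * real (card (A x \<inter> A y))"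
      using eps by simp
    finally show ?thesis .
  qed
  show thesis
  proof (rule that)
    show "t' > 0"
      unfolding t'_def by (intro add_pos_pos mult_pos_pos) (use t t0 in auto)
    show "1 - d / 2 \<in> {0<..<1}"
      using d by auto
    show "\<forall>x\<in>X. A x \<noteq> {} \<and> finite (A x) \<and> A x \<subseteq> fuzzy_ball X M x (1 - d / 2) t' \<times> UNIV"
      using ne fin ball by blast
    show "\<forall>x\<in>X. \<forall>y\<in>X. M x y t > 1 - r \<longrightarrow>
        real (card (sym_diff (A x) (A y))) < \<epsilon> * real (card (A x \<inter> A y))"
      using close by blast
    show "\<forall>x\<in>X. card (fst ` A x) \<le> n + 1"
      using proj(2) by blast
  qed
qed

end

theorem theorem3p10:
  fixes X :: "'a set" and M :: "'a \<Rightarrow> 'a \<Rightarrow> real \<Rightarrow> real"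
    and star :: "real \<Rightarrow> real \<Rightarrow> real" and n :: nat
  assumes "fuzzy_metric_space X M star"
    and "no_zero_divisors_on_unit star"
    and "uniformly_locally_finite X M"
  shows "(asdim_le X M n \<longrightarrow>
      (\<forall>\<epsilon>>0. \<forall>t>0. \<forall>r\<in>{0<..<1}. \<exists>t'>0. \<exists>r'\<in>{0<..<1}. \<exists>A :: 'a \<Rightarrow> ('a \<times> nat) set.
        (\<forall>x\<in>X. A x \<noteq> {} \<and> finite (A x) \<and> A x \<subseteq> fuzzy_ball X M x r' t' \<times> UNIV) \<and>
        (\<forall>x\<in>X. \<forall>y\<in>X. M x y t > 1 - r \<longrightarrow>
          real (card (sym_diff (A x) (A y))) < \<epsilon> * real (card (A x \<inter> A y))) \<and>
        (\<forall>x\<in>X. card (fst ` A x) \<le> n + 1)))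
    \<and> (finite_asdim X M \<longrightarrow> property_A X M)"
proof (intro conjI impI allI ballI)
  interpret fuzzy_metric_space X M star by (rule assms(1))
  fix \<epsilon> t r :: real
  assume *: "asdim_le X M n" "\<epsilon> > 0" "t > 0" "r \<in> {0<..<1}"
  obtain t' r' and A :: "'a \<Rightarrow> ('a \<times> nat) set"
    where "t' > 0" "r' \<in> {0<..<1}"
      "\<forall>x\<in>X. A x \<noteq> {} \<and> finite (A x) \<and> A x \<subseteq> fuzzy_ball X M x r' t' \<times> UNIV"
      "\<forall>x\<in>X. \<forall>y\<in>X. M x y t > 1 - r \<longrightarrow>
        real (card (sym_diff (A x) (A y))) < \<epsilon> * real (card (A x \<inter> A y))"
      "\<forall>x\<in>X. card (fst ` A x) \<le> n + 1"
    by (rule asdim_le_imp_columns[OF assms(2) *]) (rule that)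
  then show "\<exists>t'>0. \<exists>r'\<in>{0<..<1}. \<exists>A :: 'a \<Rightarrow> ('a \<times> nat) set.
      (\<forall>x\<in>X. A x \<noteq> {} \<and> finite (A x) \<and> A x \<subseteq> fuzzy_ball X M x r' t' \<times> UNIV) \<and>
      (\<forall>x\<in>X. \<forall>y\<in>X. M x y t > 1 - r \<longrightarrow>
        real (card (sym_diff (A x) (A y))) < \<epsilon> * real (card (A x \<inter> A y))) \<and>
      (\<forall>x\<in>X. card (fst ` A x) \<le> n + 1)"
    by (intro exI[of _ t'] bexI[of _ r'] exI[of _ A] conjI)
next
  interpret fuzzy_metric_space X M star by (rule assms(1))
  assume "finite_asdim X M"
  \<comment> \<open>This \<open>m\<close> is unrelated to the \<open>n\<close> of the first claim,
    so the construction is run anew and its bound on the projection discarded.\<close>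
  then obtain m where m: "asdim_le X M m"
    unfolding finite_asdim_def by blast
  show "property_A X M"
    unfolding property_A_def
  proof (intro allI impI ballI)
    fix \<epsilon> t r :: real
    assume *: "\<epsilon> > 0" "t > 0" "r \<in> {0<..<1}"
    obtain t' r' and A :: "'a \<Rightarrow> ('a \<times> nat) set"
      where "t' > 0" "r' \<in> {0<..<1}"
        "\<forall>x\<in>X. A x \<noteq> {} \<and> finite (A x) \<and> A x \<subseteq> fuzzy_ball X M x r' t' \<times> UNIV"
        "\<forall>x\<in>X. \<forall>y\<in>X. M x y t > 1 - r \<longrightarrow>
          real (card (sym_diff (A x) (A y))) < \<epsilon> * real (card (A x \<inter> A y))"
      by (rule asdim_le_imp_columns[OF assms(2) m *]) (rule that)
    then show "\<exists>t'>0. \<exists>r'\<in>{0<..<1}. \<exists>A :: 'a \<Rightarrow> ('a \<times> nat) set.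
        (\<forall>x\<in>X. A x \<noteq> {} \<and> finite (A x) \<and> A x \<subseteq> fuzzy_ball X M x r' t' \<times> UNIV) \<and>
        (\<forall>x\<in>X. \<forall>y\<in>X. M x y t > 1 - r \<longrightarrow>
          real (card (sym_diff (A x) (A y))) < \<epsilon> * real (card (A x \<inter> A y)))"
      by (intro exI[of _ t'] bexI[of _ r'] exI[of _ A] conjI)
  qed
qed

end
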